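(* Let $n\ge 1$ be an integer, let $q\in\mathbb{R}\setminus\{0,1,-1\}$ and let $A\in\mathbb{C}$. Define $$\mathcal{A}_q := \begin{cases}\{z\in\mathbb{C} : |q|^{n-1}<|z|\le |q|^n\}, & \text{if } |q|>1,\\ \{z\in\mathbb{C} : |q|^{n}\le|z|< |q|^{n-1}\}, & \text{if } 0<|q|<1.\end{cases}$$ Then: (1) If $|A|\notin\mathcal{A}_q$, then for all functions $D,R:\mathbb{R}\to\mathbb{C}$ satisfying $D(h)=R(qh)-A\,R(h)$ for all $h$, $D(h)=o(h^n)$ and $R(h)=o(h^{n-1})$, one has $R(h)=o(h^n)$. (2) If $|A|\in\mathcal{A}_q$, then there exists a function $R:\mathbb{R}\to\mathbb{C}$ such that, with $D(h):=R(qh)-A\,R(h)$, one has $D(h)=o(h^n)$ and $R(h)=o(h^{n-1})$, but it is not true that $R(h)=o(h^n)$.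
   Context: For a function $F:\mathbb{R}\to\mathbb{C}$ and an integer $m\ge 0$, $F(h)=o(h^m)$ means $\lim_{h\to 0}|F(h)|/|h|^m=0$ (limit over $h\neq 0$). *)

theory Defs
  imports Complex_Main "HOL-Library.Landau_Symbols"
begin

text \<open>\<open>o_pow F m\<close> is \<open>F(h) = o(h^m)\<close> as \<open>h\<close> tends to 0 through nonzero reals; the value \<open>F 0\<close> is irrelevant.\<close>

definition o_pow :: "(real \<Rightarrow> complex) \<Rightarrow> nat \<Rightarrow> bool" where
  "o_pow F m \<longleftrightarrow> ((\<lambda>h. norm (F h) / \<bar>h\<bar> ^ m) \<longlongrightarrow> 0) (at 0)"

lemma o_pow_iff_smallo: "o_pow F m \<longleftrightarrow> F \<in> o[at 0](\<lambda>h. complex_of_real h ^ m)"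
proof
  assume "o_pow F m"
  then have "((\<lambda>h. norm (F h / complex_of_real h ^ m)) \<longlongrightarrow> 0) (at 0)"
    by (simp add: o_pow_def norm_divide norm_power)
  then have "((\<lambda>h. F h / complex_of_real h ^ m) \<longlongrightarrow> 0) (at 0)"
    by (simp only: tendsto_norm_zero_iff)
  moreover have "eventually (\<lambda>h. complex_of_real h ^ m \<noteq> 0) (at 0)"
    by (simp add: eventually_at_filter del: power_eq_0_iff) simp
  ultimately show "F \<in> o[at 0](\<lambda>h. complex_of_real h ^ m)"
    by (rule smalloI_tendsto)
next
  assume "F \<in> o[at 0](\<lambda>h. complex_of_real h ^ m)"
  then have "((\<lambda>h. norm (F h / complex_of_real h ^ m)) \<longlongrightarrow> 0) (at 0)"
    by (intro tendsto_norm_zero smalloD_tendsto)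
  then show "o_pow F m"
    by (simp add: o_pow_def norm_divide norm_power)
qed

text \<open>Intended for \<open>n \<ge> 1\<close> and \<open>q \<notin> {0, 1, -1}\<close>, so the second branch is the case \<open>0 < \<bar>q\<bar> < 1\<close>.\<close>

definition annulus :: "nat \<Rightarrow> real \<Rightarrow> complex set" where
  "annulus n q =
    (if \<bar>q\<bar> > 1 then {z. \<bar>q\<bar> ^ (n - 1) < norm z \<and> norm z \<le> \<bar>q\<bar> ^ n}
     else {z. \<bar>q\<bar> ^ n \<le> norm z \<and> norm z < \<bar>q\<bar> ^ (n - 1)})"

end

theory Submission
  imports Defs
begin

text \<open>
  Replacing \<open>(q, A)\<close> by \<open>(1/q, 1/A)\<close> preserves the functional equation up to rescaling \<open>D\<close>,
  so one may assume \<open>\<bar>q\<bar> < 1\<close>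
  (for \<open>A = 0\<close> the claim is trivial when \<open>\<bar>q\<bar> > 1\<close>).
  If \<open>\<bar>A\<bar> < \<bar>q\<bar>\<^sup>n\<close>, then \<open>R(qh) = A R(h) + D(h)\<close> makes
  \<open>\<bar>R(h)\<bar> / \<bar>h\<bar>\<^sup>n\<close> contract, up to
  a small error, as one moves towards 0 from a fundamental annulus \<open>\<bar>q\<bar>\<delta> \<le> \<bar>h\<bar> < \<delta>\<close>, where it is
  bounded. If \<open>\<bar>A\<bar> \<ge> \<bar>q\<bar>\<^sup>n\<^sup>-\<^sup>1\<close>, one iterates \<open>R(h) = (R(qh) - D(h)) / A\<close> instead: the remainder
  \<open>A\<^sup>-\<^sup>k R(q\<^sup>kh)\<close> vanishes in the limit since \<open>R(h) = o(h\<^sup>n\<^sup>-\<^sup>1)\<close>, and the terms in \<open>D\<close> are dominated by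
  a geometric series. In between, the function with \<open>R(q\<^sup>k) = A\<^sup>k\<close> and \<open>R = 0\<close> off the orbit
  \<open>{q\<^sup>k | k \<ge> 0}\<close> is a counterexample.
\<close>

section \<open>Epsilon-delta form of little-o, and its stability under rescaling\<close>

lemma o_pow_iff:
  "o_pow F m \<longleftrightarrow> (\<forall>\<epsilon>>0. \<exists>\<delta>>0. \<forall>h. h \<noteq> 0 \<and> \<bar>h\<bar> < \<delta> \<longrightarrow> norm (F h) \<le> \<epsilon> * \<bar>h\<bar> ^ m)"
proof
  assume F: "o_pow F m"
  show "\<forall>\<epsilon>>0. \<exists>\<delta>>0. \<forall>h. h \<noteq> 0 \<and> \<bar>h\<bar> < \<delta> \<longrightarrow> norm (F h) \<le> \<epsilon> * \<bar>h\<bar> ^ m"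
  proof (intro allI impI)
    fix \<epsilon> :: real assume "\<epsilon> > 0"
    with F obtain \<delta> where "\<delta> > 0"
      and \<delta>: "\<And>h. h \<noteq> 0 \<Longrightarrow> \<bar>h\<bar> < \<delta> \<Longrightarrow> norm (F h) / \<bar>h\<bar> ^ m < \<epsilon>"
      unfolding o_pow_def LIM_def by fastforce
    have "norm (F h) \<le> \<epsilon> * \<bar>h\<bar> ^ m" if "h \<noteq> 0" "\<bar>h\<bar> < \<delta>" for h
      using \<delta>[OF that] that by (simp add: pos_divide_less_eq less_imp_le)
    with \<open>\<delta> > 0\<close> show "\<exists>\<delta>>0. \<forall>h. h \<noteq> 0 \<and> \<bar>h\<bar> < \<delta> \<longrightarrow> norm (F h) \<le> \<epsilon> * \<bar>h\<bar> ^ m"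
      by blast
  qed
next
  assume F: "\<forall>\<epsilon>>0. \<exists>\<delta>>0. \<forall>h. h \<noteq> 0 \<and> \<bar>h\<bar> < \<delta> \<longrightarrow> norm (F h) \<le> \<epsilon> * \<bar>h\<bar> ^ m"
  show "o_pow F m"
    unfolding o_pow_def LIM_def
  proof (intro allI impI)
    fix \<epsilon> :: real assume "\<epsilon> > 0"
    with F obtain \<delta> where "\<delta> > 0"
      and \<delta>: "\<And>h. h \<noteq> 0 \<Longrightarrow> \<bar>h\<bar> < \<delta> \<Longrightarrow> norm (F h) \<le> \<epsilon> / 2 * \<bar>h\<bar> ^ m"
      by (meson half_gt_zero)
    have "norm (F h) / \<bar>h\<bar> ^ m < \<epsilon>" if "h \<noteq> 0" "\<bar>h\<bar> < \<delta>" for h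
    proof -
      have "norm (F h) / \<bar>h\<bar> ^ m \<le> \<epsilon> / 2"
        using \<delta>[OF that] that by (simp add: pos_divide_le_eq)
      also have "\<dots> < \<epsilon>" using \<open>\<epsilon> > 0\<close> by simp
      finally show ?thesis .
    qed
    with \<open>\<delta> > 0\<close> show "\<exists>s>0. \<forall>x. x \<noteq> 0 \<and> dist x 0 < s \<longrightarrow>
        dist (norm (F x) / \<bar>x\<bar> ^ m) 0 < \<epsilon>"
      by (intro exI[of _ \<delta>]) simp
  qed
qed

lemma o_pow_obtain:
  assumes "o_pow F m" and "\<epsilon> > 0"
  obtains \<delta> where "\<delta> > 0" and "\<And>h. h \<noteq> 0 \<Longrightarrow> \<bar>h\<bar> < \<delta> \<Longrightarrow> norm (F h) \<le> \<epsilon> * \<bar>h\<bar> ^ m"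
  using assms unfolding o_pow_iff by blast

lemma o_pow_scale:
  assumes F: "o_pow F m" and "a \<noteq> 0"
  shows "o_pow (\<lambda>h. c * F (a * h)) m"
  unfolding o_pow_iff
proof (intro allI impI)
  fix \<epsilon> :: real assume "\<epsilon> > 0"
  \<comment> \<open>\<open>K\<close> absorbs both the factor \<open>c\<close> and the dilation by
    \<open>a\<close>; the \<open>+ 1\<close> keeps it positive when \<open>c = 0\<close>.\<close>
  define K where "K = (norm c + 1) * \<bar>a\<bar> ^ m"
  have "K > 0" using \<open>a \<noteq> 0\<close> by (simp add: K_def add_nonneg_pos)
  then have "\<epsilon> / K > 0" using \<open>\<epsilon> > 0\<close> by simp
  from o_pow_obtain[OF F this] obtain \<delta> where "\<delta> > 0"
    and \<delta>: "\<And>h. h \<noteq> 0 \<Longrightarrow> \<bar>h\<bar> < \<delta> \<Longrightarrow> norm (F h) \<le> \<epsilon> / K * \<bar>h\<bar> ^ m"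
    by blast
  have "norm (c * F (a * h)) \<le> \<epsilon> * \<bar>h\<bar> ^ m" if "h \<noteq> 0" "\<bar>h\<bar> < \<delta> / \<bar>a\<bar>" for h
  proof -
    have "norm (F (a * h)) \<le> \<epsilon> / K * \<bar>a * h\<bar> ^ m"
      using that \<open>a \<noteq> 0\<close> by (intro \<delta>) (simp_all add: abs_mult field_simps)
    then have "norm (c * F (a * h)) \<le> (norm c + 1) * (\<epsilon> / K * \<bar>a * h\<bar> ^ m)"
      unfolding norm_mult by (intro mult_mono) auto
    also have "\<dots> = (K / K) * (\<epsilon> * \<bar>h\<bar> ^ m)"
      by (simp add: K_def abs_mult power_mult_distrib)
    finally show ?thesis using \<open>K > 0\<close> by simp
  qed
  then show "\<exists>\<delta>>0. \<forall>h. h \<noteq> 0 \<and> \<bar>h\<bar> < \<delta> \<longrightarrow> norm (c * F (a * h)) \<le> \<epsilon> * \<bar>h\<bar> ^ m"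
    using \<open>\<delta> > 0\<close> \<open>a \<noteq> 0\<close> by (intro exI[of _ "\<delta> / \<bar>a\<bar>"]) simp
qed

section \<open>Little-o of order \<open>n\<close> for \<open>\<bar>q\<bar> < 1\<close> and
  \<open>norm A\<close> outside the critical range\<close>

lemma fundamental_annulus:
  fixes q h \<delta> :: real
  assumes "0 < \<bar>q\<bar>" "\<bar>q\<bar> < 1" "h \<noteq> 0" "\<bar>h\<bar> < \<delta>"
  obtains k g where "h = q ^ k * g" "\<bar>q\<bar> * \<delta> \<le> \<bar>g\<bar>" "\<bar>g\<bar> < \<delta>"
proof -
  have "\<delta> > 0" using assms by linarith
  have "\<exists>k. \<bar>q\<bar> ^ k < \<bar>h\<bar> / \<delta>"
    using real_arch_pow_inv[of "\<bar>h\<bar> / \<delta>" "\<bar>q\<bar>"] assms \<open>\<delta> > 0\<close> by simp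
  then obtain j where j: "\<bar>q\<bar> ^ j * \<delta> \<le> \<bar>h\<bar>"
    using \<open>\<delta> > 0\<close> by (auto simp: pos_less_divide_eq intro: less_imp_le)
  \<comment> \<open>The exponent sought is the predecessor of \<open>l\<close>: the inequality at
    \<open>l\<close> gives the lower bound on \<open>g\<close>, its failure at \<open>l - 1\<close>
    the upper one, and \<open>\<bar>h\<bar> < \<delta>\<close> excludes
    \<open>l = 0\<close>.\<close>
  define l where "l = (LEAST j. \<bar>q\<bar> ^ j * \<delta> \<le> \<bar>h\<bar>)"
  have l: "\<bar>q\<bar> ^ l * \<delta> \<le> \<bar>h\<bar>"
    unfolding l_def using j by (rule LeastI)
  then have "l \<noteq> 0" using assms(4) by (cases l) auto
  then obtain k where k: "l = Suc k" by (cases l) auto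
  have "\<not> \<bar>q\<bar> ^ k * \<delta> \<le> \<bar>h\<bar>"
    using not_less_Least[of k "\<lambda>j. \<bar>q\<bar> ^ j * \<delta> \<le> \<bar>h\<bar>"] k unfolding l_def by auto
  moreover have "q \<noteq> 0" using assms by auto
  ultimately show ?thesis
    using l k by (intro that[of k "h / q ^ k"]) (auto simp: power_abs abs_mult field_simps)
qed

text \<open>The functional equation only propagates bounds towards 0 and leaves the values on the
  starting annulus free; \<open>o_pow R (n - 1)\<close> supplies a bound there. Its influence decays
  like \<open>c ^ k\<close> with \<open>c = norm A / \<bar>q\<bar> ^ n\<close>.\<close>

lemma o_pow_contracting:
  assumes q: "0 < \<bar>q\<bar>" "\<bar>q\<bar> < 1" and "n \<ge> 1" and A: "norm A < \<bar>q\<bar> ^ n"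
    and D: "o_pow (\<lambda>h. R (q * h) - A * R h) n" and R: "o_pow R (n - 1)"
  shows "o_pow R n"
  unfolding o_pow_iff
proof (intro allI impI)
  fix \<epsilon> :: real assume "\<epsilon> > 0"
  define \<eta> where "\<eta> = \<epsilon> / 2"
  define c where "c = norm A / \<bar>q\<bar> ^ n"
  have "\<eta> > 0" using \<open>\<epsilon> > 0\<close> by (simp add: \<eta>_def)
  have c: "0 \<le> c" "c < 1" "norm A = c * \<bar>q\<bar> ^ n"
    using q A by (auto simp: c_def)
  \<comment> \<open>Relative to \<open>\<bar>q * h\<bar> ^ n\<close>, this allows an error
    \<open>\<eta> * (1 - c)\<close> per step, which makes \<open>\<eta>\<close> the fixed point of
    the recursion \<open>x \<mapsto> c * x + \<eta> * (1 - c)\<close> for the bound on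
    \<open>norm (R h) / \<bar>h\<bar> ^ n\<close>.\<close>
  have "\<eta> * (1 - c) * \<bar>q\<bar> ^ n > 0" using \<open>\<eta> > 0\<close> c q by simp
  from o_pow_obtain[OF D this] obtain \<delta>1 where "\<delta>1 > 0"
    and \<delta>1: "\<And>h. h \<noteq> 0 \<Longrightarrow> \<bar>h\<bar> < \<delta>1 \<Longrightarrow>
      norm (R (q * h) - A * R h) \<le> \<eta> * (1 - c) * \<bar>q\<bar> ^ n * \<bar>h\<bar> ^ n"
    by blast
  from o_pow_obtain[OF R zero_less_one] obtain \<delta>2 where "\<delta>2 > 0"
    and \<delta>2: "\<And>h. h \<noteq> 0 \<Longrightarrow> \<bar>h\<bar> < \<delta>2 \<Longrightarrow> norm (R h) \<le> 1 * \<bar>h\<bar> ^ (n - 1)"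
    by blast
  define \<delta> where "\<delta> = min \<delta>1 \<delta>2"
  have "\<delta> > 0" using \<open>\<delta>1 > 0\<close> \<open>\<delta>2 > 0\<close> by (simp add: \<delta>_def)
  \<comment> \<open>On the annulus \<open>M * \<bar>g\<bar> \<ge> 1\<close>, so one factor
    \<open>M * \<bar>g\<bar>\<close> raises the exponent from \<open>n - 1\<close> to
    \<open>n\<close>.\<close>
  define M where "M = 1 / (\<bar>q\<bar> * \<delta>)"
  have "M > 0" using q \<open>\<delta> > 0\<close> by (simp add: M_def)
  have base: "norm (R g) \<le> M * \<bar>g\<bar> ^ n" if g: "\<bar>q\<bar> * \<delta> \<le> \<bar>g\<bar>" "\<bar>g\<bar> < \<delta>" for g
  proof -
    have pos: "0 < \<bar>q\<bar> * \<delta>" using q \<open>\<delta> > 0\<close> by simp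
    then have "g \<noteq> 0" using g by auto
    have "norm (R g) \<le> 1 * \<bar>g\<bar> ^ (n - 1)"
      using \<delta>2[OF \<open>g \<noteq> 0\<close>] g by (simp add: \<delta>_def)
    also have "\<dots> \<le> (M * \<bar>g\<bar>) * \<bar>g\<bar> ^ (n - 1)"
      using g pos by (intro mult_right_mono) (simp_all add: M_def)
    also have "\<dots> = M * \<bar>g\<bar> ^ n"
      using \<open>n \<ge> 1\<close> by (cases n) auto
    finally show ?thesis .
  qed
  have iter: "norm (R (q ^ k * g)) \<le> (c ^ k * M + \<eta>) * \<bar>q ^ k * g\<bar> ^ n"
    if g: "\<bar>q\<bar> * \<delta> \<le> \<bar>g\<bar>" "\<bar>g\<bar> < \<delta>" for k g
  proof (induction k)
    case 0
    have "M * \<bar>g\<bar> ^ n \<le> (M + \<eta>) * \<bar>g\<bar> ^ n"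
      using \<open>\<eta> > 0\<close> by (intro mult_right_mono) auto
    with base[OF g] show ?case by simp
  next
    case (Suc k)
    define h where "h = q ^ k * g"
    have "0 < \<bar>q\<bar> * \<delta>" using q \<open>\<delta> > 0\<close> by simp
    then have "g \<noteq> 0" using g by auto
    then have "h \<noteq> 0" using q by (simp add: h_def)
    have "\<bar>q ^ k\<bar> \<le> 1" using q by (simp add: power_abs power_le_one)
    then have "\<bar>h\<bar> \<le> 1 * \<bar>g\<bar>" unfolding h_def abs_mult by (intro mult_right_mono) auto
    then have "\<bar>h\<bar> < \<delta>1" using g by (simp add: \<delta>_def)
    have "R (q * h) = A * R h + (R (q * h) - A * R h)" by simp
    then have "norm (R (q * h)) \<le> norm (A * R h) + norm (R (q * h) - A * R h)"
      by (metis norm_triangle_ineq)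
    also have "\<dots> \<le> c * \<bar>q\<bar> ^ n * ((c ^ k * M + \<eta>) * \<bar>h\<bar> ^ n)
        + \<eta> * (1 - c) * \<bar>q\<bar> ^ n * \<bar>h\<bar> ^ n"
      unfolding norm_mult c(3)
      using Suc.IH \<delta>1[OF \<open>h \<noteq> 0\<close> \<open>\<bar>h\<bar> < \<delta>1\<close>] c(1)
      by (intro add_mono mult_left_mono) (auto simp: h_def)
    also have "\<dots> = (c ^ Suc k * M + \<eta>) * \<bar>q * h\<bar> ^ n"
      by (simp add: abs_mult power_mult_distrib algebra_simps)
    finally show ?case by (simp add: h_def mult.assoc)
  qed
  obtain K where K: "c ^ K < \<eta> / M"
    using real_arch_pow_inv[of "\<eta> / M" c] \<open>\<eta> > 0\<close> \<open>M > 0\<close> c by auto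
  \<comment> \<open>A point reached after \<open>k\<close> steps has modulus at least
    \<open>\<bar>q\<bar> ^ Suc k * \<delta>\<close>, the extra factor being the inner edge of the
    annulus. This radius therefore forces enough steps for the decaying term to drop below
    \<open>\<eta>\<close>, the other half of \<open>\<epsilon>\<close>.\<close>
  have "norm (R h) \<le> \<epsilon> * \<bar>h\<bar> ^ n" if h: "h \<noteq> 0" "\<bar>h\<bar> < \<bar>q\<bar> ^ Suc K * \<delta>" for h
  proof -
    have "\<bar>q\<bar> ^ Suc K * \<delta> \<le> 1 * \<delta>"
      using q \<open>\<delta> > 0\<close> by (intro mult_right_mono power_le_one) auto
    then have "\<bar>h\<bar> < \<delta>" using h by simp
    from fundamental_annulus[OF q h(1) this] obtain k g
      where kg: "h = q ^ k * g" and g: "\<bar>q\<bar> * \<delta> \<le> \<bar>g\<bar>" "\<bar>g\<bar> < \<delta>" .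
    have "\<bar>q\<bar> ^ Suc k * \<delta> = \<bar>q\<bar> ^ k * (\<bar>q\<bar> * \<delta>)" by simp
    also have "\<dots> \<le> \<bar>q\<bar> ^ k * \<bar>g\<bar>" using g by (intro mult_left_mono) auto
    also have "\<dots> = \<bar>h\<bar>" by (simp add: kg abs_mult power_abs)
    also have "\<dots> < \<bar>q\<bar> ^ Suc K * \<delta>" by fact
    finally have "\<bar>q\<bar> ^ Suc k < \<bar>q\<bar> ^ Suc K" using \<open>\<delta> > 0\<close>
      by (simp only: mult_less_cancel_right_pos)
    then have "K \<le> k"
      using q power_decreasing[of "Suc k" "Suc K" "\<bar>q\<bar>"] by (cases "k \<le> K") auto
    then have "c ^ k \<le> c ^ K" using c by (intro power_decreasing) auto
    with K have "c ^ k \<le> \<eta> / M" by simp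
    with \<open>M > 0\<close> have "c ^ k * M \<le> \<eta>" by (simp only: pos_le_divide_eq)
    then have "(c ^ k * M + \<eta>) * \<bar>h\<bar> ^ n \<le> \<epsilon> * \<bar>h\<bar> ^ n"
      by (intro mult_right_mono) (auto simp: \<eta>_def)
    with iter[OF g, of k] show ?thesis by (simp add: kg)
  qed
  moreover have "\<bar>q\<bar> ^ Suc K * \<delta> > 0" using q \<open>\<delta> > 0\<close> by simp
  ultimately show "\<exists>\<delta>>0. \<forall>h. h \<noteq> 0 \<and> \<bar>h\<bar> < \<delta> \<longrightarrow> norm (R h) \<le> \<epsilon> * \<bar>h\<bar> ^ n"
    by blast
qed

text \<open>The bound on \<open>A\<close> is used twice. It gives
  \<open>norm A > \<bar>q\<bar> ^ n\<close>, so the series in the defect converges, and it gives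
  \<open>\<bar>q\<bar> ^ (n - 1) / norm A \<le> 1\<close>, so dividing by \<open>A ^ k\<close> does
  not outweigh the decay of \<open>R (q ^ k * h)\<close>.\<close>

lemma o_pow_expanding:
  assumes q: "0 < \<bar>q\<bar>" "\<bar>q\<bar> < 1" and "n \<ge> 1" and A: "norm A \<ge> \<bar>q\<bar> ^ (n - 1)"
    and D: "o_pow (\<lambda>h. R (q * h) - A * R h) n" and R: "o_pow R (n - 1)"
  shows "o_pow R n"
  unfolding o_pow_iff
proof (intro allI impI)
  fix \<epsilon> :: real assume "\<epsilon> > 0"
  define a where "a = norm A"
  have "a > 0" using less_le_trans[OF zero_less_power[OF q(1)] A] by (simp add: a_def)
  have "\<bar>q\<bar> ^ n < \<bar>q\<bar> ^ (n - 1)"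
    using q \<open>n \<ge> 1\<close> by (intro power_strict_decreasing) auto
  then have aq: "a - \<bar>q\<bar> ^ n > 0" using A by (simp add: a_def)
  \<comment> \<open>The geometric series with terms
    \<open>\<bar>q\<bar> ^ (n * j) / a ^ (j + 1)\<close> sums to
    \<open>1 / (a - \<bar>q\<bar> ^ n)\<close>; with this factor the accumulated error stays below
    \<open>\<epsilon> * \<bar>h\<bar> ^ n\<close> for every \<open>k\<close>.\<close>
  with \<open>\<epsilon> > 0\<close> have "\<epsilon> * (a - \<bar>q\<bar> ^ n) > 0" by simp
  from o_pow_obtain[OF D this] obtain \<delta> where "\<delta> > 0"
    and \<delta>: "\<And>h. h \<noteq> 0 \<Longrightarrow> \<bar>h\<bar> < \<delta> \<Longrightarrow>
      norm (R (q * h) - A * R h) \<le> \<epsilon> * (a - \<bar>q\<bar> ^ n) * \<bar>h\<bar> ^ n"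
    by blast
  have iter: "norm (R h) \<le> norm (R (q ^ k * h)) / a ^ k + \<epsilon> * \<bar>h\<bar> ^ n"
    if "h \<noteq> 0" "\<bar>h\<bar> < \<delta>" for h k
    using that
  proof (induction k arbitrary: h)
    case 0
    then show ?case using \<open>\<epsilon> > 0\<close> by simp
  next
    case (Suc k)
    have "\<bar>q * h\<bar> \<le> 1 * \<bar>h\<bar>" using q unfolding abs_mult by (intro mult_right_mono) auto
    then have IH: "norm (R (q * h)) \<le> norm (R (q ^ k * (q * h))) / a ^ k + \<epsilon> * \<bar>q * h\<bar> ^ n"
      using Suc.prems q by (intro Suc.IH) auto
    have "a * norm (R h) = norm (R (q * h) - (R (q * h) - A * R h))"
      by (simp add: a_def norm_mult)
    also have "\<dots> \<le> norm (R (q * h)) + norm (R (q * h) - A * R h)"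
      by (rule norm_triangle_ineq4)
    also have "\<dots> \<le> (norm (R (q ^ k * (q * h))) / a ^ k + \<epsilon> * \<bar>q * h\<bar> ^ n)
        + \<epsilon> * (a - \<bar>q\<bar> ^ n) * \<bar>h\<bar> ^ n"
      by (intro add_mono IH \<delta> Suc.prems)
    also have "\<dots> = a * (norm (R (q ^ Suc k * h)) / a ^ Suc k + \<epsilon> * \<bar>h\<bar> ^ n)"
      using \<open>a > 0\<close> by (simp add: abs_mult power_mult_distrib algebra_simps)
    finally show ?case using \<open>a > 0\<close> by simp
  qed
  have "norm (R h) \<le> \<epsilon> * \<bar>h\<bar> ^ n" if h: "h \<noteq> 0" "\<bar>h\<bar> < \<delta>" for h
  \<comment> \<open>Here \<open>h\<close> is fixed and only \<open>k\<close> grows, so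
    \<open>\<eta>\<close> may depend on \<open>h\<close>, and \<open>\<delta>\<close> does not
    depend on \<open>e\<close>.\<close>
  proof (rule field_le_epsilon)
    fix e :: real assume "e > 0"
    define \<eta> where "\<eta> = e / \<bar>h\<bar> ^ (n - 1)"
    have "\<eta> > 0" using \<open>e > 0\<close> h by (simp add: \<eta>_def)
    from o_pow_obtain[OF R this] obtain \<delta>2 where "\<delta>2 > 0"
      and \<delta>2: "\<And>h. h \<noteq> 0 \<Longrightarrow> \<bar>h\<bar> < \<delta>2 \<Longrightarrow> norm (R h) \<le> \<eta> * \<bar>h\<bar> ^ (n - 1)"
      by blast
    obtain k where "\<bar>q\<bar> ^ k < \<delta>2 / \<bar>h\<bar>"
      using real_arch_pow_inv[of "\<delta>2 / \<bar>h\<bar>" "\<bar>q\<bar>"] \<open>\<delta>2 > 0\<close> h q by auto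
    then have "\<bar>q ^ k * h\<bar> < \<delta>2" using h by (simp add: abs_mult power_abs pos_less_divide_eq)
    then have "norm (R (q ^ k * h)) \<le> \<eta> * \<bar>q ^ k * h\<bar> ^ (n - 1)"
      using h q by (intro \<delta>2) auto
    also have "\<dots> = (\<bar>q\<bar> ^ (n - 1)) ^ k * e"
      using h by (simp add: \<eta>_def abs_mult power_abs power_mult_distrib mult.commute flip: power_mult)
    also have "\<dots> \<le> a ^ k * e"
      using A \<open>e > 0\<close> by (intro mult_right_mono power_mono) (auto simp: a_def)
    finally have "norm (R (q ^ k * h)) / a ^ k \<le> e"
      using \<open>a > 0\<close> by (simp add: pos_divide_le_eq mult.commute)
    with iter[OF h, of k] show "norm (R h) \<le> \<epsilon> * \<bar>h\<bar> ^ n + e" by simp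
  qed
  with \<open>\<delta> > 0\<close> show "\<exists>\<delta>>0. \<forall>h. h \<noteq> 0 \<and> \<bar>h\<bar> < \<delta> \<longrightarrow> norm (R h) \<le> \<epsilon> * \<bar>h\<bar> ^ n"
    by blast
qed

section \<open>Sharpness: a function supported on one orbit\<close>

lemma orbit_counterexample:
  assumes q: "0 < \<bar>q\<bar>" "\<bar>q\<bar> < 1" and A: "\<bar>q\<bar> ^ n \<le> norm A" "norm A < \<bar>q\<bar> ^ (n - 1)"
  obtains R where "o_pow (\<lambda>h. R (q * h) - A * R h) n" "o_pow R (n - 1)" "\<not> o_pow R n"
proof -
  define R where "R h = (if \<exists>k. h = q ^ k then A ^ (THE k. h = q ^ k) else 0)" for h
  \<comment> \<open>This makes the exponent in \<open>R\<close> well defined; absolute values are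
    compared because \<open>q\<close> may be negative.\<close>
  have inj: "k = l" if "q ^ k = q ^ l" for k l :: nat
  proof -
    have "\<bar>q\<bar> ^ k = \<bar>q\<bar> ^ l" using that by (metis power_abs)
    then show ?thesis
      using power_strict_decreasing[of k l "\<bar>q\<bar>"] power_strict_decreasing[of l k "\<bar>q\<bar>"] q
      by (metis less_irrefl nat_neq_iff)
  qed
  have R_pow: "R (q ^ k) = A ^ k" for k
  proof -
    have "(THE l. q ^ k = q ^ l) = k" using inj by (intro the_equality) auto
    then show ?thesis by (auto simp: R_def)
  qed
  have R_0: "R h = 0" if "\<And>k. h \<noteq> q ^ k" for h
    using that by (simp add: R_def)
  \<comment> \<open>The defect vanishes only locally: at \<open>h = inverse q\<close> the point
    \<open>q * h\<close> is the start 1 of the orbit while \<open>h\<close> lies off it, so the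
    defect there is 1.\<close>
  have "R (q * h) - A * R h = 0" if "\<bar>h\<bar> < 1" for h
  proof (cases "\<exists>k. h = q ^ k")
    case True
    then obtain k where "h = q ^ k" by blast
    then show ?thesis using R_pow[of k] R_pow[of "Suc k"] by simp
  next
    case False
    have "q * h \<noteq> q ^ k" for k
    proof (cases k)
      case 0
      have "\<bar>q * h\<bar> < 1" using abs_mult_less[OF q(2) that] by (simp add: abs_mult)
      then show ?thesis using 0 by auto
    next
      case (Suc j)
      then show ?thesis using False q by auto
    qed
    then show ?thesis using False R_0 by auto
  qed
  then have 1: "o_pow (\<lambda>h. R (q * h) - A * R h) n"
    unfolding o_pow_iff by (auto intro!: exI[of _ 1])
  have 2: "o_pow R (n - 1)"
    unfolding o_pow_iff
  proof (intro allI impI)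
    fix \<epsilon> :: real assume "\<epsilon> > 0"
    \<comment> \<open>At \<open>h = q ^ k\<close> the ratio
      \<open>norm (R h) / \<bar>h\<bar> ^ (n - 1)\<close> is exactly \<open>c ^ k\<close>.\<close>
    define c where "c = norm A / \<bar>q\<bar> ^ (n - 1)"
    have c: "0 \<le> c" "c < 1" "norm A = c * \<bar>q\<bar> ^ (n - 1)" using A q by (auto simp: c_def)
    obtain K where K: "c ^ K < \<epsilon>" using real_arch_pow_inv[OF \<open>\<epsilon> > 0\<close> \<open>c < 1\<close>] by blast
    have "norm (R h) \<le> \<epsilon> * \<bar>h\<bar> ^ (n - 1)" if h: "\<bar>h\<bar> < \<bar>q\<bar> ^ K" for h
    proof (cases "\<exists>k. h = q ^ k")
      case True
      then obtain k where k: "h = q ^ k" by blast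
      have "K \<le> k"
        using h q power_decreasing[of k K "\<bar>q\<bar>"] by (cases "k \<le> K") (auto simp: k power_abs)
      then have "c ^ k \<le> c ^ K" using c by (intro power_decreasing) auto
      then have "c ^ k * \<bar>h\<bar> ^ (n - 1) \<le> \<epsilon> * \<bar>h\<bar> ^ (n - 1)"
        using K by (intro mult_right_mono) auto
      moreover have "norm (R h) = c ^ k * \<bar>h\<bar> ^ (n - 1)"
        by (simp add: k R_pow norm_power c(3) power_mult_distrib power_abs mult.commute
            flip: power_mult)
      ultimately show ?thesis by simp
    next
      case False
      then show ?thesis using R_0[of h] \<open>\<epsilon> > 0\<close> by auto
    qed
    then show "\<exists>\<delta>>0. \<forall>h. h \<noteq> 0 \<and> \<bar>h\<bar> < \<delta> \<longrightarrow> norm (R h) \<le> \<epsilon> * \<bar>h\<bar> ^ (n - 1)"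
      using q by (intro exI[of _ "\<bar>q\<bar> ^ K"]) auto
  qed
  have 3: "\<not> o_pow R n"
  proof
    assume "o_pow R n"
    \<comment> \<open>Along the orbit \<open>norm (R h) / \<bar>h\<bar> ^ n\<close> is at least 1,
      so any constant below 1 yields the contradiction.\<close>
    from o_pow_obtain[OF this, of "1/2"] obtain \<delta> where "\<delta> > 0"
      and \<delta>: "\<And>h. h \<noteq> 0 \<Longrightarrow> \<bar>h\<bar> < \<delta> \<Longrightarrow> norm (R h) \<le> 1/2 * \<bar>h\<bar> ^ n"
      by auto
    obtain k where k: "\<bar>q\<bar> ^ k < \<delta>" using real_arch_pow_inv[OF \<open>\<delta> > 0\<close> q(2)] by blast
    have "(\<bar>q\<bar> ^ n) ^ k \<le> norm A ^ k" using A q by (intro power_mono) auto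
    also have "\<dots> = norm (R (q ^ k))" by (simp add: R_pow norm_power)
    also have "\<dots> \<le> 1/2 * \<bar>q ^ k\<bar> ^ n" using k q by (intro \<delta>) (auto simp: power_abs)
    also have "\<dots> = 1/2 * (\<bar>q\<bar> ^ n) ^ k" by (simp add: power_abs mult.commute flip: power_mult)
    finally have "(\<bar>q\<bar> ^ n) ^ k \<le> 0" by simp
    moreover have "(\<bar>q\<bar> ^ n) ^ k > 0" using q by (intro zero_less_power)
    ultimately show False by simp
  qed
  from 1 2 3 show ?thesis by (rule that)
qed

section \<open>Inverting \<open>q\<close> and \<open>A\<close>, and assembly of the cases\<close>

lemma q_equation_inverse:
  fixes R :: "real \<Rightarrow> complex"
  assumes "q \<noteq> 0" "A \<noteq> 0"
  shows "R (inverse q * h) - inverse A * R h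
      = - inverse A * (R (q * (inverse q * h)) - A * R (inverse q * h))"
  using assms by (simp add: algebra_simps)

theorem corollary8:
  fixes n :: nat and q :: real and A :: complex
  assumes "n \<ge> 1" and "q \<notin> {0, 1, -1}"
  shows "(complex_of_real (norm A) \<notin> annulus n q \<longrightarrow>
           (\<forall>D R :: real \<Rightarrow> complex.
              (\<forall>h. D h = R (q * h) - A * R h) \<and> o_pow D n \<and> o_pow R (n - 1)
              \<longrightarrow> o_pow R n))
       \<and> (complex_of_real (norm A) \<in> annulus n q \<longrightarrow>
           (\<exists>R :: real \<Rightarrow> complex.
              o_pow (\<lambda>h. R (q * h) - A * R h) n \<and> o_pow R (n - 1) \<and> \<not> o_pow R n))"
proof (intro conjI impI allI)
  fix D R :: "real \<Rightarrow> complex"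
  assume nA: "complex_of_real (norm A) \<notin> annulus n q"
    and *: "(\<forall>h. D h = R (q * h) - A * R h) \<and> o_pow D n \<and> o_pow R (n - 1)"
  then have "D = (\<lambda>h. R (q * h) - A * R h)" by auto
  with * have D: "o_pow (\<lambda>h. R (q * h) - A * R h) n" and R: "o_pow R (n - 1)" by auto
  have "q \<noteq> 0" using assms by simp
  show "o_pow R n"
  proof (cases "\<bar>q\<bar> > 1")
    case True
    let ?p = "inverse q"
    have p: "0 < \<bar>?p\<bar>" "\<bar>?p\<bar> < 1"
      using True \<open>q \<noteq> 0\<close> by (auto simp: abs_inverse inverse_less_1_iff)
    show ?thesis
    proof (cases "A = 0")
      case True
      \<comment> \<open>For \<open>A = 0\<close> the defect is \<open>R (q * h)\<close>, so
        \<open>R\<close> is a rescaling of it.\<close>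
      then show ?thesis using o_pow_scale[OF D, of ?p 1] \<open>q \<noteq> 0\<close> by (simp flip: mult.assoc)
    next
      case False
      have D': "o_pow (\<lambda>h. R (?p * h) - inverse A * R h) n"
        unfolding q_equation_inverse[OF \<open>q \<noteq> 0\<close> False] using \<open>q \<noteq> 0\<close>
        by (intro o_pow_scale[OF D]) auto
      \<comment> \<open>Inversion reverses both inequalities: small \<open>norm A\<close> leads to
        the expanding case and large \<open>norm A\<close> to the contracting one, with the
        strictness at each endpoint matching.\<close>
      have "norm A \<le> \<bar>q\<bar> ^ (n - 1) \<or> \<bar>q\<bar> ^ n < norm A"
        using nA True by (auto simp: annulus_def)
      then have "norm (inverse A) \<ge> \<bar>?p\<bar> ^ (n - 1) \<or> norm (inverse A) < \<bar>?p\<bar> ^ n"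
        using False \<open>q \<noteq> 0\<close>
        by (auto simp: norm_inverse abs_inverse power_inverse intro!: le_imp_inverse_le less_imp_inverse_less)
      then show ?thesis
        using o_pow_expanding[OF p assms(1) _ D' R] o_pow_contracting[OF p assms(1) _ D' R]
        by blast
    qed
  next
    case False
    then have q: "0 < \<bar>q\<bar>" "\<bar>q\<bar> < 1" using assms(2) by auto
    have "norm A < \<bar>q\<bar> ^ n \<or> \<bar>q\<bar> ^ (n - 1) \<le> norm A"
      using nA False by (auto simp: annulus_def)
    then show ?thesis
      using o_pow_expanding[OF q assms(1) _ D R] o_pow_contracting[OF q assms(1) _ D R]
      by blast
  qed
next
  assume A: "complex_of_real (norm A) \<in> annulus n q"
  have "q \<noteq> 0" using assms by simp
  show "\<exists>R. o_pow (\<lambda>h. R (q * h) - A * R h) n \<and> o_pow R (n - 1) \<and> \<not> o_pow R n"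
  proof (cases "\<bar>q\<bar> > 1")
    case True
    let ?p = "inverse q"
    have p: "0 < \<bar>?p\<bar>" "\<bar>?p\<bar> < 1"
      using True \<open>q \<noteq> 0\<close> by (auto simp: abs_inverse inverse_less_1_iff)
    have nA: "\<bar>q\<bar> ^ (n - 1) < norm A" "norm A \<le> \<bar>q\<bar> ^ n"
      using A True by (auto simp: annulus_def)
    then have "0 < norm A" by (meson abs_ge_zero le_less_trans zero_le_power)
    then have "A \<noteq> 0" by simp
    have "\<bar>?p\<bar> ^ n \<le> norm (inverse A)" "norm (inverse A) < \<bar>?p\<bar> ^ (n - 1)"
      using nA \<open>A \<noteq> 0\<close> \<open>q \<noteq> 0\<close>
      by (auto simp: norm_inverse abs_inverse power_inverse intro!: le_imp_inverse_le less_imp_inverse_less)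
    from orbit_counterexample[OF p this] obtain R
      where D: "o_pow (\<lambda>h. R (?p * h) - inverse A * R h) n"
        and R: "o_pow R (n - 1)" "\<not> o_pow R n" .
    \<comment> \<open>The same \<open>R\<close> serves: inverting the pair
      \<open>(?p, inverse A)\<close> returns \<open>(q, A)\<close>, and the defect changes by the
      factor \<open>- A\<close> and a dilation by \<open>q\<close>.\<close>
    have "o_pow (\<lambda>h. R (q * h) - A * R h) n"
      using o_pow_scale[OF D \<open>q \<noteq> 0\<close>, of "- A"]
        q_equation_inverse[of ?p "inverse A" R] \<open>q \<noteq> 0\<close> \<open>A \<noteq> 0\<close> by simp
    with R show ?thesis by blast
  next
    case False
    then have q: "0 < \<bar>q\<bar>" "\<bar>q\<bar> < 1" using assms(2) by auto
    have "\<bar>q\<bar> ^ n \<le> norm A" "norm A < \<bar>q\<bar> ^ (n - 1)"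
      using A False by (auto simp: annulus_def)
    from orbit_counterexample[OF q this] show ?thesis by blast
  qed
qed

end
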